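(* Let $\mathcal I,\mathcal J$ be ideals on an infinite set $X$. If $\mathtt{cof}^{\mathcal J}(\mathcal I)>1$, then $$(\mathcal I,\nsupseteq)\preceq_{\mathrm T}(\mathcal I,\nsupseteq^{\mathcal J})\preceq_{\mathrm T}(\mathcal I,\subseteq^{\mathcal J})\preceq_{\mathrm T}(\mathcal I,\subseteq).$$ As a consequence, if $\mathtt{cof}^{\mathcal J}(\mathcal I)>1$, then $$\omega\le\mathtt{add}(\mathcal I)\le\mathtt{add}^{\mathcal J}(\mathcal I)\le\mathtt{cof}^{\mathcal J}(\mathcal I)\le\mathtt{cof}(\mathcal I).$$
   Context: An ideal on an infinite set $X$ is a family $\mathcal I\subseteq\mathcal P(X)$ closed under subsets and finite unions, with $X\notin\mathcal I$ and $[X]^{<\omega}\subseteq\mathcal I$; by convention $\{\emptyset\}$ is also regarded as an ideal on $X$. Write $A\subseteq^{\mathcal J}B$ (equivalently $B\supseteq^{\mathcal J}A$) for $A\setminus B\in\mathcal J$; $\nsupseteq$, $\nsupseteq^{\mathcal J}$ are the negations of $\supseteq$, $\supseteq^{\mathcal J}$. A relational system is a triple $\mathbf R=(X,Y,\sqsubset)$ with $X,Y$ nonempty sets and ${\sqsubset}\subseteq X\times Y$; $(X,\sqsubset)$ abbreviates $(X,X,\sqsubset)$. A Tukey connection from $(X,Y,\sqsubset)$ to $(X',Y',\sqsubset')$ is a pair of maps $\Psi_-:X\to X'$, $\Psi_+:Y'\to Y$ such that for all $x\in X$, $y'\in Y'$: $\Psi_-(x)\sqsubset' y'$ implies $x\sqsubset\Psi_+(y')$.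 Write $\mathbf R\preceq_{\mathrm T}\mathbf R'$ if there is a Tukey connection from $\mathbf R$ to $\mathbf R'$. Cardinals (with $\min\emptyset=\infty$): $\mathtt{add}(\mathcal I)=\min\{|\mathcal A|:\mathcal A\subseteq\mathcal I,\ \bigcup\mathcal A\notin\mathcal I\}$; $\mathtt{cof}(\mathcal I)=\min\{|\mathcal B|:\mathcal B\subseteq\mathcal I,\ \forall I\in\mathcal I\ \exists B\in\mathcal B\ I\subseteq B\}$; $\mathtt{add}^{\mathcal J}(\mathcal I)=\min\{|\mathcal A|:\mathcal A\subseteq\mathcal I,\ \forall I\in\mathcal I\ \exists A\in\mathcal A\ A\setminus I\notin\mathcal J\}$; $\mathtt{cof}^{\mathcal J}(\mathcal I)=\min\{|\mathcal A|:\mathcal A\subseteq\mathcal I,\ \forall I\in\mathcal I\ \exists A\in\mathcal A\ I\setminus A\in\mathcal J\}$. *)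

theory Defs
  imports Main
begin

unbundle cardinal_syntax

definition ideal_on :: "'a set \<Rightarrow> 'a set set \<Rightarrow> bool" where
  "ideal_on X I \<longleftrightarrow>
     I = {{}} \<or>
     (I \<subseteq> Pow X \<and>
      (\<forall>A B. A \<in> I \<and> B \<subseteq> A \<longrightarrow> B \<in> I) \<and>
      (\<forall>A B. A \<in> I \<and> B \<in> I \<longrightarrow> A \<union> B \<in> I) \<and>
      X \<notin> I \<and>
      (\<forall>F. F \<subseteq> X \<and> finite F \<longrightarrow> F \<in> I))"

definition subset_mod :: "'a set set \<Rightarrow> 'a set \<Rightarrow> 'a set \<Rightarrow> bool" where
  "subset_mod J A B \<longleftrightarrow> A - B \<in> J"

type_synonym ('x, 'y) relsys = "'x set \<times> 'y set \<times> ('x \<times> 'y) set"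

fun relational_system :: "('x, 'y) relsys \<Rightarrow> bool" where
  "relational_system (X, Y, r) \<longleftrightarrow> X \<noteq> {} \<and> Y \<noteq> {} \<and> r \<subseteq> X \<times> Y"

definition relsys_on :: "'x set \<Rightarrow> ('x \<Rightarrow> 'x \<Rightarrow> bool) \<Rightarrow> ('x, 'x) relsys" where
  "relsys_on X P = (X, X, {(x, y). x \<in> X \<and> y \<in> X \<and> P x y})"

fun tukey_connection ::
  "('x, 'y) relsys \<Rightarrow> ('u, 'v) relsys \<Rightarrow> ('x \<Rightarrow> 'u) \<Rightarrow> ('v \<Rightarrow> 'y) \<Rightarrow> bool" where
  "tukey_connection (X, Y, r) (X', Y', r') f g \<longleftrightarrow>
     f ` X \<subseteq> X' \<and> g ` Y' \<subseteq> Y \<and>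
     (\<forall>x\<in>X. \<forall>y'\<in>Y'. (f x, y') \<in> r' \<longrightarrow> (x, g y') \<in> r)"

definition tukey_le :: "('x, 'y) relsys \<Rightarrow> ('u, 'v) relsys \<Rightarrow> bool" (infix "\<preceq>\<^sub>T" 50) where
  "R \<preceq>\<^sub>T R' \<longleftrightarrow>
     relational_system R \<and> relational_system R' \<and> (\<exists>f g. tukey_connection R R' f g)"

text \<open>
  Cardinals are the library's well-order relations compared by \<open>\<le>o\<close>, extended by a
  largest element \<open>Infty\<close> serving as the minimum of the empty set of cardinals.
  The comparisons are heterogeneous because each cardinal is represented on some type.
\<close>

datatype 'b ecard = Card "'b rel" | Infty

fun ecard_le :: "'b ecard \<Rightarrow> 'c ecard \<Rightarrow> bool" (infix "\<le>c" 50) where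
  "(k \<le>c Infty) = True"
| "(Infty \<le>c Card s) = False"
| "(Card r \<le>c Card s) = (r \<le>o s)"

fun ecard_less :: "'b ecard \<Rightarrow> 'c ecard \<Rightarrow> bool" (infix "<c" 50) where
  "(Infty <c k) = False"
| "(Card r <c Infty) = True"
| "(Card r <c Card s) = (r <o s)"

text \<open>
  \<open>min_card F\<close> is the minimum of \<open>|A|\<close> over all \<open>A \<in> F\<close>. The representative
  chosen below is determined only up to \<open>=o\<close>, which the comparisons respect.
\<close>

definition min_card :: "'b set set \<Rightarrow> 'b ecard" where
  "min_card F =
     (if F = {} then Infty
      else Card (SOME r. (\<exists>A\<in>F. r = |A| ) \<and> (\<forall>B\<in>F. r \<le>o |B| )))"

lemma min_card_attained:
  assumes "F \<noteq> {}"
  shows "\<exists>A\<in>F. min_card F = Card |A| \<and> (\<forall>B\<in>F. |A| \<le>o |B| )"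
proof -
  have "\<exists>r\<in>card_of ` F. \<forall>r'\<in>card_of ` F. r \<le>o r'"
    using assms by (intro exists_minim_Card_order) (auto simp: card_of_Card_order)
  then have "\<exists>r. (\<exists>A\<in>F. r = |A| ) \<and> (\<forall>B\<in>F. r \<le>o |B| )"
    by auto
  from someI_ex[OF this] show ?thesis
    using assms by (auto simp: min_card_def)
qed

definition add :: "'a set set \<Rightarrow> 'a set ecard" where
  "add I = min_card {\<A>. \<A> \<subseteq> I \<and> \<Union>\<A> \<notin> I}"

definition cof :: "'a set set \<Rightarrow> 'a set ecard" where
  "cof I = min_card {\<B>. \<B> \<subseteq> I \<and> (\<forall>A\<in>I. \<exists>B\<in>\<B>. A \<subseteq> B)}"

definition add_mod :: "'a set set \<Rightarrow> 'a set set \<Rightarrow> 'a set ecard" where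
  "add_mod J I = min_card {\<A>. \<A> \<subseteq> I \<and> (\<forall>B\<in>I. \<exists>A\<in>\<A>. A - B \<notin> J)}"

definition cof_mod :: "'a set set \<Rightarrow> 'a set set \<Rightarrow> 'a set ecard" where
  "cof_mod J I = min_card {\<A>. \<A> \<subseteq> I \<and> (\<forall>B\<in>I. \<exists>A\<in>\<A>. B - A \<in> J)}"

end

theory Submission
  imports Defs
begin

text \<open>
  If no single \<open>C \<in> I\<close> dominates \<open>I\<close> modulo \<open>J\<close>, choose \<open>g C \<in> I\<close> not below \<open>C\<close> modulo \<open>J\<close>.
  Transitivity modulo \<open>J\<close> then shows that whenever \<open>A\<close> lies below \<open>B\<close>, \<open>g B\<close> does not lie
  below \<open>A\<close>. So \<open>(id, g)\<close> is the middle Tukey connection, and \<open>g\<close> maps families cofinal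
  modulo \<open>J\<close> to families unbounded modulo \<open>J\<close>.
\<close>

lemma ideal_on_empty: "ideal_on X I \<Longrightarrow> {} \<in> I"
  by (auto simp: ideal_on_def)

lemma ideal_on_subset: "ideal_on X I \<Longrightarrow> A \<in> I \<Longrightarrow> B \<subseteq> A \<Longrightarrow> B \<in> I"
  unfolding ideal_on_def by blast

lemma ideal_on_Un: "ideal_on X I \<Longrightarrow> A \<in> I \<Longrightarrow> B \<in> I \<Longrightarrow> A \<union> B \<in> I"
  unfolding ideal_on_def by blast

lemma ideal_on_Union_finite:
  assumes "ideal_on X I" "finite \<A>" "\<A> \<subseteq> I"
  shows "\<Union>\<A> \<in> I"
  using assms(2,3)
  by (induction) (auto simp: ideal_on_empty[OF assms(1)] ideal_on_Un[OF assms(1)])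

lemma subset_mod_if_subset: "ideal_on X J \<Longrightarrow> A \<subseteq> B \<Longrightarrow> subset_mod J A B"
  unfolding subset_mod_def by (metis Diff_eq_empty_iff ideal_on_empty)

lemma subset_mod_trans:
  assumes "ideal_on X J" "subset_mod J A B" "subset_mod J B C"
  shows "subset_mod J A C"
proof -
  have "(A - B) \<union> (B - C) \<in> J"
    using assms by (auto simp: subset_mod_def intro: ideal_on_Un)
  moreover have "A - C \<subseteq> (A - B) \<union> (B - C)" by blast
  ultimately show ?thesis
    unfolding subset_mod_def using assms(1) by (blast intro: ideal_on_subset)
qed

text \<open>Minima are attained, so it suffices to turn a smallest member of \<open>F\<close> into a
  member of \<open>G\<close> that is no larger. Empty \<open>F\<close> is harmless, since its
  minimum is \<open>Infty\<close>. This carries a map between families, such as the image under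
  \<open>g\<close>, over to their minima.\<close>

lemma min_card_le:
  assumes "\<And>A. A \<in> F \<Longrightarrow> \<exists>B\<in>G. |B| \<le>o |A|"
  shows "min_card G \<le>c min_card F"
proof (cases "F = {}")
  case True
  then show ?thesis by (simp add: min_card_def)
next
  case False
  then obtain A where A: "A \<in> F" "min_card F = Card |A|"
    using min_card_attained by blast
  then obtain B where B: "B \<in> G" "|B| \<le>o |A|"
    using assms by blast
  then obtain C where "min_card G = Card |C|" "|C| \<le>o |B|"
    using min_card_attained[of G] by blast
  with A B show ?thesis by (auto intro: ordLeq_transitive)
qed

lemma min_card_antimono: "F \<subseteq> G \<Longrightarrow> min_card G \<le>c min_card F"
  by (rule min_card_le) (blast intro: card_of_refl ordIso_imp_ordLeq)

lemma natLeq_le_min_card: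
  assumes "\<And>A. A \<in> F \<Longrightarrow> infinite A"
  shows "Card natLeq \<le>c min_card F"
proof (cases "F = {}")
  case True
  then show ?thesis by (simp add: min_card_def)
next
  case False
  then obtain A where "A \<in> F" "min_card F = Card |A|"
    using min_card_attained by blast
  with assms show ?thesis
    using infinite_iff_natLeq_ordLeq[of A] by simp
qed

text \<open>A set \<open>C\<close> in \<open>I\<close> dominating all of \<open>I\<close> modulo
  \<open>J\<close> would make the singleton \<open>{C}\<close> cofinal, forcing the cofinality
  modulo \<open>J\<close> down to at most one.\<close>

lemma cof_mod_gt_one_unbounded:
  assumes "Card cone <c cof_mod J I" "C \<in> I"
  shows "\<exists>B\<in>I. \<not> subset_mod J B C"
proof (rule ccontr)
  let ?F = "{\<A>. \<A> \<subseteq> I \<and> (\<forall>B\<in>I. \<exists>A\<in>\<A>. B - A \<in> J)}"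
  assume "\<not> ?thesis"
  then have C: "{C} \<in> ?F"
    using assms(2) by (simp add: subset_mod_def)
  \<comment> \<open>Nonemptiness rules out the default value \<open>Infty\<close>, so the minimum is
    attained and bounded by \<open>|{C}|\<close>.\<close>
  then have "?F \<noteq> {}" by (metis empty_iff)
  from min_card_attained[OF this]
  obtain A where "min_card ?F = Card |A|" "\<forall>B\<in>?F. |A| \<le>o |B|"
    by (elim bexE conjE)
  with C have A: "cof_mod J I = Card |A|" "|A| \<le>o |{C}|"
    unfolding cof_mod_def by (simp, elim bspec)
  from assms(1) A have "cone <o |{C}|"
    by (auto intro: ordLess_ordLeq_trans)
  \<comment> \<open>\<open>cone\<close> is the cardinal of a one-element set of another type, hence
    the heterogeneous comparison.\<close>
  moreover have "|{C}| \<le>o cone"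
    unfolding cone_def by (rule card_of_singl_ordLeq) simp
  ultimately show False
    by (simp add: not_ordLess_ordLeq)
qed

lemma tukey_leI:
  assumes "S \<noteq> {}" "f ` S \<subseteq> S" "g ` S \<subseteq> S"
    and "\<And>A B. A \<in> S \<Longrightarrow> B \<in> S \<Longrightarrow> Q (f A) B \<Longrightarrow> P A (g B)"
  shows "relsys_on S P \<preceq>\<^sub>T relsys_on S Q"
proof -
  have "tukey_connection (relsys_on S P) (relsys_on S Q) f g"
    using assms by (auto simp: relsys_on_def)
  then show ?thesis
    using assms(1) by (auto simp: tukey_le_def relsys_on_def)
qed

theorem lemma3p2:
  fixes X :: "'a set" and I J :: "'a set set"
  assumes "infinite X" and "ideal_on X I" and "ideal_on X J"
    and "Card cone <c cof_mod J I"
  shows "(relsys_on I (\<lambda>A B. \<not> B \<subseteq> A) \<preceq>\<^sub>T relsys_on I (\<lambda>A B. \<not> subset_mod J B A) \<and>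
          relsys_on I (\<lambda>A B. \<not> subset_mod J B A) \<preceq>\<^sub>T relsys_on I (subset_mod J) \<and>
          relsys_on I (subset_mod J) \<preceq>\<^sub>T relsys_on I (\<subseteq>)) \<and>
         (Card natLeq \<le>c add I \<and> add I \<le>c add_mod J I \<and>
          add_mod J I \<le>c cof_mod J I \<and> cof_mod J I \<le>c cof I)"
proof -
  have ne: "I \<noteq> {}"
    using ideal_on_empty[OF assms(2)] by blast
  have J_subset: "subset_mod J A B" if "A \<subseteq> B" for A B
    using subset_mod_if_subset[OF assms(3) that] .
  obtain g where g: "g C \<in> I" "\<not> subset_mod J (g C) C" if "C \<in> I" for C
    using bchoice[of I "\<lambda>C B. B \<in> I \<and> \<not> subset_mod J B C"]
      cof_mod_gt_one_unbounded[OF assms(4)] by blast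
  have g_unbounded: "\<not> subset_mod J (g B) A" if "B \<in> I" "subset_mod J A B" for A B
    using g(2) that subset_mod_trans[OF assms(3)] by blast

  have t1: "relsys_on I (\<lambda>A B. \<not> B \<subseteq> A) \<preceq>\<^sub>T relsys_on I (\<lambda>A B. \<not> subset_mod J B A)"
    \<comment> \<open>Inclusion implies inclusion modulo \<open>J\<close>; the contrapositive makes
      the identity maps work.\<close>
    by (rule tukey_leI[where f = id and g = id]) (use ne J_subset in auto)
  have t2: "relsys_on I (\<lambda>A B. \<not> subset_mod J B A) \<preceq>\<^sub>T relsys_on I (subset_mod J)"
    by (rule tukey_leI[where f = id and g = g]) (use ne g(1) g_unbounded in auto)
  have t3: "relsys_on I (subset_mod J) \<preceq>\<^sub>T relsys_on I (\<subseteq>)"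
    by (rule tukey_leI[where f = id and g = id]) (use ne J_subset in auto)

  have c1: "Card natLeq \<le>c add I"
    unfolding add_def
    \<comment> \<open>Finite unions stay in \<open>I\<close>, so a family whose union leaves
      \<open>I\<close> is infinite.\<close>
    by (rule natLeq_le_min_card) (use ideal_on_Union_finite[OF assms(2)] in blast)
  have c2: "add I \<le>c add_mod J I"
    unfolding add_def add_mod_def
  proof (rule min_card_antimono, safe)
    fix \<A> assume \<A>: "\<forall>B\<in>I. \<exists>A\<in>\<A>. A - B \<notin> J" and "\<Union>\<A> \<in> I"
    \<comment> \<open>If the union were in \<open>I\<close>, it would itself bound the family modulo
      \<open>J\<close>.\<close>
    then obtain A where "A \<in> \<A>" "A - \<Union>\<A> \<notin> J" by blast
    then show False
      using J_subset[of A "\<Union>\<A>"] by (auto simp: subset_mod_def)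
  qed
  have c3: "add_mod J I \<le>c cof_mod J I"
    unfolding add_mod_def cof_mod_def
  proof (rule min_card_le)
    fix \<A> assume "\<A> \<in> {\<A>. \<A> \<subseteq> I \<and> (\<forall>B\<in>I. \<exists>A\<in>\<A>. B - A \<in> J)}"
    then have \<A>: "\<A> \<subseteq> I" "\<forall>B\<in>I. \<exists>A\<in>\<A>. subset_mod J B A"
      by (simp_all add: subset_mod_def)
    have "\<exists>A\<in>g ` \<A>. \<not> subset_mod J A B" if B: "B \<in> I" for B
    proof -
      obtain A where "A \<in> \<A>" "subset_mod J B A"
        using bspec[OF \<A>(2) B] by (elim bexE)
      moreover from this have "A \<in> I"
        using \<A>(1) by (elim subsetD)
      \<comment> \<open>Since \<open>B\<close> lies below \<open>A\<close> modulo \<open>J\<close>,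
        the witness \<open>g A\<close> cannot lie below \<open>B\<close>.\<close>
      ultimately show ?thesis
        using g_unbounded by (intro bexI[of _ "g A"]) simp_all
    qed
    moreover have "g ` \<A> \<subseteq> I"
      by (intro image_subsetI g(1) subsetD[OF \<A>(1)])
    ultimately have "g ` \<A> \<in> {\<A>. \<A> \<subseteq> I \<and> (\<forall>B\<in>I. \<exists>A\<in>\<A>. A - B \<notin> J)}"
      by (simp add: subset_mod_def)
    then show "\<exists>\<B>\<in>{\<A>. \<A> \<subseteq> I \<and> (\<forall>B\<in>I. \<exists>A\<in>\<A>. A - B \<notin> J)}. |\<B>| \<le>o |\<A>|"
      by (rule rev_bexI) (rule card_of_image)
  qed
  have c4: "cof_mod J I \<le>c cof I"
    unfolding cof_mod_def cof_def
  \<comment> \<open>Every cofinal family is cofinal modulo \<open>J\<close>, so the minimum for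
    \<open>cof_mod\<close> ranges over more families.\<close>
  proof (rule min_card_antimono, safe)
    fix \<B> B assume "\<forall>A\<in>I. \<exists>B\<in>\<B>. A \<subseteq> B" "B \<in> I"
    then show "\<exists>A\<in>\<B>. B - A \<in> J"
      using J_subset unfolding subset_mod_def by blast
  qed
  from t1 t2 t3 c1 c2 c3 c4 show ?thesis by simp
qed

end
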